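(* Let $C_{\mathrm{PB}}$ be the positive-body chasing constant described in the context (an absolute constant for chasing positive bodies at resource augmentation $\epsilon=1$ and covering-row support at most $2$). For all integers $m,k\ge 1$ and every integral initial state $x_0\in X_{m,k}$, there is a causal deterministic integral online algorithm for Dynamic Mixture-of-Experts Serving such that every finite sequence of nonnegative workload vectors $r_1,\dots,r_T\in\mathbb{R}_{\ge 0}^m$ satisfies \[ \operatorname{ALG}_{\rm det}\le 10\,C_{\mathrm{PB}}\cdot \operatorname{OPT}+(5C_{\mathrm{PB}}+8)k+16 . \] In particular the multiplicative constant $10\,C_{\mathrm{PB}}$ is independent of $m$, $k$, the initial state, the horizon $T$ and the workloads.
   Context: **Dynamic Mixture-of-Experts Serving.** Fix integers $m\ge1$ and $k\ge1$. The integral state space is $X_{m,k}=\{x\in\mathbb{Z}_{\ge0}^m:\sum_{i=1}^m x_i=k\}$. An initial state $x_0\in X_{m,k}$ is part of the instance. At round $t=1,\dots,T$ a workload vector $r_t\in\mathbb{R}_{\ge0}^m$ is revealed; the online algorithm then chooses $x_t\in X_{m,k}$ and pays $f_t(x_t)+\lVert x_t-x_{t-1}\rVert_1$, where \[ f_t(x)=\max_{1\le i\le m}\frac{r_{t,i}}{1+x_i}. \] $\operatorname{ALG}_{\rm det}$ is the total cost $\sum_{t=1}^T\big(f_t(x_t)+\lVert x_t-x_{t-1}\rVert_1\big)$ of the algorithm. $\operatorname{OPT}$ is the minimum of this total cost over all integral paths $x_1,\dots,x_T\in X_{m,k}$ starting from the same $x_0$, for the given workload sequence. A deterministic algorithm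 is causal if equal request prefixes produce equal allocation prefixes, i.e. $x_t$ is a function of $r_1,\dots,r_t$ only (given $m,k,x_0$; the horizon $T$ is not known in advance). **The constant $C_{\mathrm{PB}}$.** A positive body in $\mathbb{R}^D$ is a set $K=\{z\in\mathbb{R}_{\ge0}^D: Cz\ge\mathbf 1,\ Pz\le\mathbf 1\}$, where $C$ and $P$ are entrywise nonnegative real matrices with finitely many rows (possibly none). $C_{\mathrm{PB}}$ is a constant with the following property, whose existence is a published theorem on Chasing Positive Bodies (Bhattacharya, Buchbinder, Levin, Saranurak, 2023) and is taken as given. For every dimension $D$ there is a deterministic causal online algorithm which, on any finite sequence of nonempty positive bodies $K_t=\{z\in\mathbb{R}_{\ge0}^D: C^tz\ge\mathbf 1,\ P^tz\le\mathbf 1\}$ ($t=1,\dots,N$), revealed one at a time, in which every row of every $C^t$ has at most two nonzero entries, outputs points $z_t\in\mathbb{R}_{\ge0}^D$ (depending only on the bodies revealed up to time $t$) with $C^tz_t\ge\mathbf 1$ and $P^tz_t\le 2\cdot\mathbf 1$, such that, with $z_0=0$, \[ \sum_{t=1}^N\lVert z_t-z_{t-1}\rVert_1\le C_{\mathrm{PB}}\sum_{t=1}^N\lVert z_t^*-z_{t-1}^*\rVert_1 \] for every offline path with $z_0^*=0$ and $z_t^*\in K_t$ for $t=1,\dots,N$. The same constant works for all $D$, all $N$ and all such sequences. *)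

theory Defs
  imports Complex_Main "Jordan_Normal_Form.Matrix"
begin

text \<open>
  Vectors and matrices are those of \<open>Jordan_Normal_Form\<close>, since dimensions are quantified inside
  definitions. Coordinates are numbered from \<open>0\<close>, rounds from \<open>1\<close>: the request of round \<open>t\<close> in a
  list \<open>rs\<close> is \<open>rs ! (t - 1)\<close>. The order \<open>v \<le> w\<close> on vectors is entrywise and
  includes equality of dimensions.
\<close>

definition l1_norm :: "real vec \<Rightarrow> real" where
  "l1_norm v = (\<Sum>i<dim_vec v. \<bar>v $ i\<bar>)"

text \<open>
  A deterministic causal algorithm is a function \<open>A\<close> from the request prefix \<open>r\<^sub>1, \<dots>, r\<^sub>t\<close> to the
  point chosen in round \<open>t\<close>.
\<close>

definition online_path :: "'s \<Rightarrow> ('r list \<Rightarrow> 's) \<Rightarrow> 'r list \<Rightarrow> nat \<Rightarrow> 's" where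
  "online_path s0 A rs t = (if t = 0 then s0 else A (take t rs))"


section \<open>Chasing positive bodies\<close>

text \<open>
  A body is presented to the algorithm by its pair \<open>(C, P)\<close> of covering and packing matrices.
  The parameter \<open>b\<close> relaxes the packing constraints: \<open>b = 1\<close> is the body itself, and \<open>b = 2\<close> is
  what the algorithm is held to.
\<close>

definition positive_body :: "nat \<Rightarrow> real \<Rightarrow> real mat \<times> real mat \<Rightarrow> real vec set" where
  "positive_body D b = (\<lambda>(C, P).
     {z \<in> carrier_vec D. 0\<^sub>v D \<le> z \<and>
        vec (dim_row C) (\<lambda>_. 1) \<le> C *\<^sub>v z \<and>
        P *\<^sub>v z \<le> vec (dim_row P) (\<lambda>_. b)})"

definition nonneg_mat :: "real mat \<Rightarrow> bool" where
  "nonneg_mat M \<longleftrightarrow> (\<forall>i<dim_row M. \<forall>j<dim_col M. 0 \<le> M $$ (i, j))"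

definition admissible_body :: "nat \<Rightarrow> real mat \<times> real mat \<Rightarrow> bool" where
  "admissible_body D = (\<lambda>(C, P).
     dim_col C = D \<and> dim_col P = D \<and> nonneg_mat C \<and> nonneg_mat P \<and>
     (\<forall>i<dim_row C. card {j. j < D \<and> C $$ (i, j) \<noteq> 0} \<le> 2) \<and>
     positive_body D 1 (C, P) \<noteq> {})"

definition movement :: "nat \<Rightarrow> (nat \<Rightarrow> real vec) \<Rightarrow> real" where
  "movement N z = (\<Sum>t = 1..N. l1_norm (z t - z (t - 1)))"

definition is_pb_constant :: "real \<Rightarrow> bool" where
  "is_pb_constant c \<longleftrightarrow>
     (\<forall>D. \<exists>A :: (real mat \<times> real mat) list \<Rightarrow> real vec.
        \<forall>Ks. (\<forall>K\<in>set Ks. admissible_body D K) \<longrightarrow>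
          (let z = online_path (0\<^sub>v D) A Ks in
            (\<forall>t\<in>{1..length Ks}. z t \<in> positive_body D 2 (Ks ! (t - 1))) \<and>
            (\<forall>z'. z' 0 = 0\<^sub>v D \<and>
                   (\<forall>t\<in>{1..length Ks}. z' t \<in> positive_body D 1 (Ks ! (t - 1))) \<longrightarrow>
                   movement (length Ks) z \<le> c * movement (length Ks) z')))"


section \<open>Dynamic Mixture-of-Experts Serving\<close>

definition states :: "nat \<Rightarrow> nat \<Rightarrow> nat vec set" where
  "states m k = {x \<in> carrier_vec m. (\<Sum>i<m. x $ i) = k}"

definition workloads :: "nat \<Rightarrow> real vec set" where
  "workloads m = {r \<in> carrier_vec m. 0\<^sub>v m \<le> r}"

definition service_cost :: "real vec \<Rightarrow> nat vec \<Rightarrow> real" where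
  "service_cost r x = Max ((\<lambda>i. r $ i / (1 + real (x $ i))) ` {..<dim_vec r})"

definition switching_cost :: "nat vec \<Rightarrow> nat vec \<Rightarrow> real" where
  "switching_cost x y = l1_norm (map_vec real y - map_vec real x)"

definition total_cost :: "real vec list \<Rightarrow> (nat \<Rightarrow> nat vec) \<Rightarrow> real" where
  "total_cost rs x =
     (\<Sum>t = 1..length rs. service_cost (rs ! (t - 1)) (x t) + switching_cost (x (t - 1)) (x t))"

definition paths :: "nat \<Rightarrow> nat \<Rightarrow> nat vec \<Rightarrow> nat \<Rightarrow> (nat \<Rightarrow> nat vec) set" where
  "paths m k x0 T = {x. x 0 = x0 \<and> (\<forall>t\<in>{1..T}. x t \<in> states m k)}"

text \<open>
  There are infinitely many functions in \<open>paths\<close>, because values after the horizon are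
  unconstrained, but only finitely many costs; see \<open>finite_path_costs\<close> below.
\<close>

definition OPT :: "nat \<Rightarrow> nat \<Rightarrow> nat vec \<Rightarrow> real vec list \<Rightarrow> real" where
  "OPT m k x0 rs = Min (total_cost rs ` paths m k x0 (length rs))"

definition ALG :: "nat vec \<Rightarrow> (real vec list \<Rightarrow> nat vec) \<Rightarrow> real vec list \<Rightarrow> real" where
  "ALG x0 A rs = total_cost rs (online_path x0 A rs)"

lemma finite_states: "finite (states m k)"
proof -
  have "x \<in> vec m ` (PiE {..<m} (\<lambda>_. {..k}))" if "x \<in> states m k" for x
  proof -
    have x: "dim_vec x = m" "(\<Sum>i<m. x $ i) = k" using that by (auto simp: states_def)
    have "x $ i \<le> k" if "i < m" for i
      using member_le_sum[of i "{..<m}" "\<lambda>i. x $ i"] that x by auto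
    then have "restrict (\<lambda>i. x $ i) {..<m} \<in> PiE {..<m} (\<lambda>_. {..k})" by auto
    moreover have "x = vec m (restrict (\<lambda>i. x $ i) {..<m})" using x by auto
    ultimately show ?thesis by blast
  qed
  then have "states m k \<subseteq> vec m ` (PiE {..<m} (\<lambda>_. {..k}))" by blast
  then show ?thesis by (rule finite_subset) (simp add: finite_PiE)
qed

lemma finite_path_costs: "finite (total_cost rs ` paths m k x0 (length rs))"
proof -
  let ?T = "length rs"
  let ?S = "PiE {..?T} (\<lambda>_. insert x0 (states m k))"
  have "total_cost rs x \<in> total_cost rs ` ?S" if "x \<in> paths m k x0 ?T" for x
  proof (rule image_eqI)
    show "restrict x {..?T} \<in> ?S"
    proof (rule restrict_PiE_iff[THEN iffD2], intro ballI)
      fix t assume "t \<in> {..?T}"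
      then show "x t \<in> insert x0 (states m k)"
        using that by (cases t) (auto simp: paths_def)
    qed
    show "total_cost rs x = total_cost rs (restrict x {..?T})"
      unfolding total_cost_def by (intro sum.cong) auto
  qed
  then have "total_cost rs ` paths m k x0 ?T \<subseteq> total_cost rs ` ?S" by blast
  then show ?thesis by (rule finite_subset) (simp add: finite_PiE finite_states)
qed

lemma OPT_attained:
  assumes "x0 \<in> states m k"
  shows "\<exists>x\<in>paths m k x0 (length rs). OPT m k x0 rs = total_cost rs x"
proof -
  have "(\<lambda>_. x0) \<in> paths m k x0 (length rs)" using assms by (simp add: paths_def)
  then have "OPT m k x0 rs \<in> total_cost rs ` paths m k x0 (length rs)"
    unfolding OPT_def by (intro Min_in finite_path_costs) auto
  then show ?thesis by blast
qed

lemma OPT_le: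
  assumes "x \<in> paths m k x0 (length rs)"
  shows "OPT m k x0 rs \<le> total_cost rs x"
  unfolding OPT_def using assms by (intro Min_le finite_path_costs) auto

end

theory Submission imports Defs begin

text \<open>
  Each round is presented to the positive-body algorithm as two bodies over the fractional allocation
  \<open>x\<close> and an extra coordinate \<open>s\<close>. The first imposes tangents to the hyperbolas
  \<open>s (1 + x\<^sub>i) = r\<^sub>i\<close>, which are covering constraints of support two valid at every allocation whose
  service cost is at most \<open>s\<close>, together with \<open>\<Sum>x\<^sub>i \<le> k\<close>; the second forces \<open>s\<close> back to nearly \<open>0\<close>, so
  that the service cost is paid as movement of \<open>s\<close>, once up and once down.

  The chasing algorithm only guarantees \<open>\<Sum>x\<^sub>i \<le> 2 k\<close>, so half of \<open>x\<close> is rounded: single units are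
  moved from coordinates with more than \<open>x\<^sub>i / 2\<close> to coordinates \<open>i\<close> with \<open>x\<^sub>i \<ge> 2 X\<^sub>i + 3\<close>. The potential
  \<open>\<Sum>max 0 (x\<^sub>i - 2 X\<^sub>i - 1)\<close> drops by more than 1 with each such exchange and grows at most by the movement
  of \<open>x\<close>, and once no coordinate is starved the service cost is at most \<open>4 s\<close>.
\<close>

section \<open>Bodies given by row functions\<close>

definition row_mat :: "nat \<Rightarrow> (nat \<Rightarrow> real) list \<Rightarrow> real mat" where
  "row_mat D fs = mat (length fs) D (\<lambda>(a, j). (fs ! a) j)"

lemma row_mat_dim [simp]: "dim_row (row_mat D fs) = length fs" "dim_col (row_mat D fs) = D"
  by (simp_all add: row_mat_def)

lemma row_mat_mult:
  assumes "z \<in> carrier_vec D" "a < length fs"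
  shows "(row_mat D fs *\<^sub>v z) $ a = (\<Sum>j<D. (fs ! a) j * z $ j)"
  using assms by (simp add: row_mat_def scalar_prod_def atLeast0LessThan)

lemma positive_body_row_mat:
  "z \<in> positive_body D b (row_mat D cs, row_mat D ps) \<longleftrightarrow>
     z \<in> carrier_vec D \<and> (\<forall>j<D. 0 \<le> z $ j) \<and>
     (\<forall>c\<in>set cs. 1 \<le> (\<Sum>j<D. c j * z $ j)) \<and> (\<forall>p\<in>set ps. (\<Sum>j<D. p j * z $ j) \<le> b)"
  by (auto simp: positive_body_def less_eq_vec_def row_mat_mult all_set_conv_all_nth
      simp del: index_mult_mat_vec)

lemma admissible_body_row_mat:
  assumes "\<And>c j. c \<in> set cs \<Longrightarrow> j < D \<Longrightarrow> 0 \<le> c j" "\<And>p j. p \<in> set ps \<Longrightarrow> j < D \<Longrightarrow> 0 \<le> p j"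
    and "\<And>c. c \<in> set cs \<Longrightarrow> card {j. j < D \<and> c j \<noteq> 0} \<le> 2"
    and "z \<in> positive_body D 1 (row_mat D cs, row_mat D ps)"
  shows "admissible_body D (row_mat D cs, row_mat D ps)"
proof -
  have "{j. j < D \<and> row_mat D cs $$ (i, j) \<noteq> 0} = {j. j < D \<and> (cs ! i) j \<noteq> 0}"
    if "i < length cs" for i
    using that by (auto simp: row_mat_def)
  moreover have "nonneg_mat (row_mat D cs)" "nonneg_mat (row_mat D ps)"
    using assms(1,2) by (auto simp: nonneg_mat_def row_mat_def)
  ultimately show ?thesis
    using assms(3,4) by (auto simp: admissible_body_def)
qed

lemma l1_norm_nonneg: "0 \<le> l1_norm v"
  by (simp add: l1_norm_def sum_nonneg)

lemma movement_nonneg: "0 \<le> movement N z"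
  by (simp add: movement_def sum_nonneg l1_norm_nonneg)

text \<open>On the single body \<open>z \<ge> 1\<close> in dimension one, jumping to 1 is an offline
  path of movement 1, so \<open>c\<close> bounds a nonnegative movement. The sign allows bounds on
  offline movement to be multiplied by the constant.\<close>

lemma is_pb_constant_nonneg:
  assumes "is_pb_constant c"
  shows "0 \<le> c"
proof -
  let ?K = "(row_mat 1 [\<lambda>_. 1], row_mat 1 [])"
  let ?z = "\<lambda>t. if t = 0 then 0\<^sub>v 1 else vec 1 (\<lambda>_. 1 :: real)"
  have z: "vec 1 (\<lambda>_. 1) \<in> positive_body 1 1 ?K"
    by (simp add: positive_body_row_mat)
  have "admissible_body 1 ?K"
    by (rule admissible_body_row_mat[OF _ _ _ z]) auto
  then have adm: "\<forall>K\<in>set [?K]. admissible_body 1 K" by simp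
  obtain A :: "(real mat \<times> real mat) list \<Rightarrow> real vec" where
    A: "\<And>Ks z'. \<forall>K\<in>set Ks. admissible_body 1 K \<Longrightarrow>
       z' 0 = 0\<^sub>v 1 \<and> (\<forall>t\<in>{1..length Ks}. z' t \<in> positive_body 1 1 (Ks ! (t - 1))) \<Longrightarrow>
       movement (length Ks) (online_path (0\<^sub>v 1) A Ks) \<le> c * movement (length Ks) z'"
    using assms unfolding is_pb_constant_def Let_def by metis
  have "movement (length [?K]) (online_path (0\<^sub>v 1) A [?K]) \<le> c * movement (length [?K]) ?z"
    by (rule A[OF adm]) (use z in auto)
  moreover have "movement (length [?K]) ?z = 1"
    by (simp add: movement_def l1_norm_def)
  ultimately show ?thesis
    using movement_nonneg[of "length [?K]" "online_path (0\<^sub>v 1) A [?K]"] by simp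
qed


section \<open>The bodies of a workload sequence\<close>

text \<open>
  Coordinates below \<open>m\<close> carry the fractional allocation \<open>x\<close>, coordinate \<open>m\<close> the service cost \<open>s\<close>.
  A row is the tangent to the hyperbola \<open>s (1 + x\<^sub>i) = r\<close> at \<open>1 + x\<^sub>i = 2 y + 4\<close>, normalised to right-hand
  side \<open>1\<close>.
\<close>

definition cover_row :: "nat \<Rightarrow> real \<Rightarrow> nat \<Rightarrow> nat \<Rightarrow> nat \<Rightarrow> real" where
  "cover_row m r i y j =
     (if j = m then (2 * real y + 4)\<^sup>2 / (r * (4 * real y + 7))
      else if j = i then 1 / (4 * real y + 7) else 0)"

text \<open>Tangents up to \<open>y = k\<close> suffice because no coordinate of a state exceeds
  \<open>k\<close>. A zero workload gets no row, as the normalisation divides by it.\<close>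

definition serve_body :: "nat \<Rightarrow> nat \<Rightarrow> real vec \<Rightarrow> real mat \<times> real mat" where
  "serve_body m k r =
     (row_mat (Suc m) [cover_row m (r $ i) i y. i \<leftarrow> [0..<m], y \<leftarrow> [0..<Suc k], 0 < r $ i],
      row_mat (Suc m) [\<lambda>j. if j < m then 1 / real k else 0])"

text \<open>
  Forcing \<open>s\<close> back to nearly \<open>0\<close> after each round turns the service cost into movement. The bound
  cannot be \<open>0\<close> in a packing constraint, so it is made summable over the rounds.
\<close>

definition reset_body :: "nat \<Rightarrow> nat \<Rightarrow> real mat \<times> real mat" where
  "reset_body m t = (row_mat (Suc m) [], row_mat (Suc m) [\<lambda>j. if j = m then 2 ^ Suc t else 0])"

text \<open>List indices start at 0 but chasing rounds at 1, so \<open>rs ! t\<close> is answered at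
  position \<open>Suc (2 * t)\<close> and the reset after it at
  \<open>Suc (Suc (2 * t))\<close>.\<close>

definition bodies :: "nat \<Rightarrow> nat \<Rightarrow> real vec list \<Rightarrow> (real mat \<times> real mat) list" where
  "bodies m k rs =
     map (\<lambda>n. if even n then serve_body m k (rs ! (n div 2)) else reset_body m (n div 2))
       [0..<2 * length rs]"

lemma length_bodies [simp]: "length (bodies m k rs) = 2 * length rs"
  by (simp add: bodies_def)

lemma nth_bodies:
  assumes "t < length rs"
  shows "bodies m k rs ! (2 * t) = serve_body m k (rs ! t)"
    and "bodies m k rs ! Suc (2 * t) = reset_body m t"
  using assms by (simp_all add: bodies_def)

lemma bodies_take:
  assumes "t \<le> length rs"
  shows "bodies m k (take t rs) = take (2 * t) (bodies m k rs)"
  using assms by (intro nth_equalityI) (auto simp: bodies_def)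

lemma cover_row_nonneg: "0 < r \<Longrightarrow> 0 \<le> cover_row m r i y j"
  by (simp add: cover_row_def)

lemma sum_cover_row:
  assumes "i < m"
  shows "(\<Sum>j<Suc m. cover_row m r i y j * z $ j)
    = z $ i / (4 * real y + 7) + (2 * real y + 4)\<^sup>2 / (r * (4 * real y + 7)) * z $ m"
proof -
  have "(\<Sum>j<m. cover_row m r i y j * z $ j) = (\<Sum>j<m. if j = i then z $ i / (4 * real y + 7) else 0)"
    by (intro sum.cong) (auto simp: cover_row_def)
  also have "\<dots> = z $ i / (4 * real y + 7)"
    using assms by simp
  finally show ?thesis
    by (simp add: cover_row_def)
qed

lemma cover_row_iff:
  assumes "i < m" "0 < r"
  shows "1 \<le> (\<Sum>j<Suc m. cover_row m r i y j * z $ j) \<longleftrightarrow>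
    r * (4 * real y + 7) \<le> r * z $ i + (2 * real y + 4)\<^sup>2 * z $ m"
proof -
  have "z $ i / (4 * real y + 7) + (2 * real y + 4)\<^sup>2 / (r * (4 * real y + 7)) * z $ m
      = (r * z $ i + (2 * real y + 4)\<^sup>2 * z $ m) / (r * (4 * real y + 7))"
    using assms(2) by (simp add: add_divide_distrib)
  moreover have "0 < r * (4 * real y + 7)"
    using assms(2) by simp
  ultimately show ?thesis
    unfolding sum_cover_row[OF assms(1)] by (simp add: le_divide_eq del: zero_less_mult_iff)
qed

lemma serve_body_iff:
  assumes "1 \<le> k"
  shows "z \<in> positive_body (Suc m) b (serve_body m k r) \<longleftrightarrow>
     z \<in> carrier_vec (Suc m) \<and> (\<forall>j<Suc m. 0 \<le> z $ j) \<and>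
     (\<forall>i<m. \<forall>y\<le>k. 0 < r $ i \<longrightarrow>
        r $ i * (4 * real y + 7) \<le> r $ i * z $ i + (2 * real y + 4)\<^sup>2 * z $ m) \<and>
     (\<Sum>j<m. z $ j) \<le> b * real k"
proof -
  have "(\<Sum>j<Suc m. (if j < m then 1 / real k else 0) * z $ j) = (\<Sum>j<m. z $ j) / real k"
    by (simp add: sum_divide_distrib)
  then have "(\<Sum>j<Suc m. (if j < m then 1 / real k else 0) * z $ j) \<le> b \<longleftrightarrow> (\<Sum>j<m. z $ j) \<le> b * real k"
    using assms by (simp add: divide_le_eq)
  moreover have "(\<forall>c\<in>set [cover_row m (r $ i) i y. i \<leftarrow> [0..<m], y \<leftarrow> [0..<Suc k], 0 < r $ i].
        1 \<le> (\<Sum>j<Suc m. c j * z $ j)) \<longleftrightarrow>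
     (\<forall>i<m. \<forall>y\<le>k. 0 < r $ i \<longrightarrow> 1 \<le> (\<Sum>j<Suc m. cover_row m (r $ i) i y j * z $ j))"
    by (auto simp del: sum.lessThan_Suc upt_Suc simp: less_Suc_eq_le)
  ultimately show ?thesis
    unfolding serve_body_def positive_body_row_mat by (simp add: cover_row_iff del: sum.lessThan_Suc upt_Suc)
qed

lemma reset_body_iff:
  "z \<in> positive_body (Suc m) b (reset_body m t) \<longleftrightarrow>
     z \<in> carrier_vec (Suc m) \<and> (\<forall>j<Suc m. 0 \<le> z $ j) \<and> 2 ^ Suc t * z $ m \<le> b"
proof -
  have "(\<Sum>j<Suc m. (if j = m then 2 ^ Suc t else 0) * z $ j) = 2 ^ Suc t * z $ m"
    by simp
  then show ?thesis
    unfolding reset_body_def positive_body_row_mat by (simp del: sum.lessThan_Suc power_Suc)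
qed


section \<open>Integral states as points of the bodies\<close>

definition lift :: "nat \<Rightarrow> nat vec \<Rightarrow> real \<Rightarrow> real vec" where
  "lift m x s = vec (Suc m) (\<lambda>j. if j < m then real (x $ j) else s)"

lemma service_cost_ge:
  assumes "r \<in> workloads m" "i < m"
  shows "r $ i / (1 + real (x $ i)) \<le> service_cost r x"
  unfolding service_cost_def using assms by (intro Max_ge imageI) (auto simp: workloads_def)

lemma service_cost_le:
  assumes "r \<in> workloads m" "1 \<le> m" "\<And>i. i < m \<Longrightarrow> r $ i / (1 + real (x $ i)) \<le> c"
  shows "service_cost r x \<le> c"
  unfolding service_cost_def using assms by (subst Max_le_iff) (auto simp: workloads_def lessThan_empty_iff)

lemma workload_nonneg: "r \<in> workloads m \<Longrightarrow> i < m \<Longrightarrow> 0 \<le> r $ i"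
  unfolding workloads_def less_eq_vec_def
  by (metis (no_types, lifting) carrier_vecD index_zero_vec(1) mem_Collect_eq)

lemma service_cost_nonneg:
  assumes "r \<in> workloads m" "1 \<le> m"
  shows "0 \<le> service_cost r x"
proof -
  have "0 \<le> r $ 0 / (1 + real (x $ 0))"
    using workload_nonneg[OF assms(1), of 0] assms(2) by simp
  then show ?thesis
    using service_cost_ge[OF assms(1), of 0 x] assms(2) by simp
qed

lemma states_sum: "x \<in> states m k \<Longrightarrow> (\<Sum>i<m. real (x $ i)) = real k"
  unfolding of_nat_sum[symmetric] by (simp add: states_def)

lemma lift_in_serve_body:
  assumes "r \<in> workloads m" "1 \<le> m" "1 \<le> k" "x \<in> states m k"
  shows "lift m x (service_cost r x) \<in> positive_body (Suc m) 1 (serve_body m k r)"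
  unfolding serve_body_iff[OF assms(3)]
proof (intro conjI allI impI)
  fix i y assume i: "i < m" "y \<le> k" "0 < r $ i"
  define b c where "b = 2 * real y + 4" and "c = 1 + real (x $ i)"
  have c: "c > 0" by (simp add: c_def)
  have "r $ i / c \<le> service_cost r x"
    using service_cost_ge[OF assms(1) i(1), of x] by (simp add: c_def)
  then have "b\<^sup>2 * (r $ i / c) \<le> b\<^sup>2 * service_cost r x"
    by (intro mult_left_mono) auto
  \<comment> \<open>Convexity: the hyperbola \<open>r / c\<close> lies above its tangent at
    \<open>b\<close>, and the gap times \<open>b\<^sup>2\<close> is
    \<open>r / c * (b - c)\<^sup>2\<close>.\<close>
  moreover have "r $ i * (2 * b - 1) \<le> r $ i * (c - 1) + b\<^sup>2 * (r $ i / c)"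
  proof -
    have "0 \<le> r $ i / c * (b - c)\<^sup>2"
      using i c by simp
    also have "\<dots> = r $ i * (c - 1) + b\<^sup>2 * (r $ i / c) - r $ i * (2 * b - 1)"
      using c by (simp add: field_simps power2_eq_square)
    finally show ?thesis by simp
  qed
  ultimately show "r $ i * (4 * real y + 7) \<le> r $ i * lift m x (service_cost r x) $ i
      + (2 * real y + 4)\<^sup>2 * lift m x (service_cost r x) $ m"
    using i by (simp add: lift_def b_def c_def algebra_simps)
next
  show "(\<Sum>j<m. lift m x (service_cost r x) $ j) \<le> 1 * real k"
    using states_sum[OF assms(4)] by (simp add: lift_def)
qed (use service_cost_nonneg[OF assms(1,2), of x] in \<open>simp_all add: lift_def\<close>)

lemma lift_in_reset_body: "lift m x 0 \<in> positive_body (Suc m) 1 (reset_body m t)"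
  unfolding reset_body_iff by (auto simp: lift_def)

lemma admissible_serve_body:
  assumes "r \<in> workloads m" "1 \<le> m" "1 \<le> k" "x \<in> states m k"
  shows "admissible_body (Suc m) (serve_body m k r)"
proof -
  have "card {j. j < Suc m \<and> cover_row m (r $ i) i y j \<noteq> 0} \<le> 2" for i y
  proof -
    have "card {j. j < Suc m \<and> cover_row m (r $ i) i y j \<noteq> 0} \<le> card {m, i}"
      by (intro card_mono) (auto simp: cover_row_def split: if_splits)
    also have "\<dots> \<le> 2" by (simp add: card_insert_if)
    finally show ?thesis .
  qed
  then show ?thesis
    unfolding serve_body_def
    by (intro admissible_body_row_mat[OF _ _ _ lift_in_serve_body[OF assms, unfolded serve_body_def]])
      (auto simp: cover_row_nonneg split: if_splits)
qed

lemma admissible_reset_body: "admissible_body (Suc m) (reset_body m t)"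
  unfolding reset_body_def
  by (rule admissible_body_row_mat[OF _ _ _ lift_in_reset_body[of m "0\<^sub>v m", unfolded reset_body_def]]) auto

lemma admissible_bodies:
  assumes "set rs \<subseteq> workloads m" "1 \<le> m" "1 \<le> k" "x \<in> states m k"
  shows "\<forall>K\<in>set (bodies m k rs). admissible_body (Suc m) K"
  using admissible_serve_body[OF _ assms(2-4)] assms(1) admissible_reset_body
  by (auto simp: bodies_def subset_iff)


section \<open>Movement\<close>

definition xdist :: "nat \<Rightarrow> real vec \<Rightarrow> real vec \<Rightarrow> real" where
  "xdist m v w = (\<Sum>i<m. \<bar>v $ i - w $ i\<bar>)"

lemma xdist_nonneg: "0 \<le> xdist m v w"
  by (simp add: xdist_def sum_nonneg)

lemma l1_norm_diff:
  assumes "v \<in> carrier_vec (Suc m)" "w \<in> carrier_vec (Suc m)"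
  shows "l1_norm (v - w) = xdist m v w + \<bar>v $ m - w $ m\<bar>"
  using assms by (simp add: l1_norm_def xdist_def)

lemma switching_cost_eq:
  assumes "x \<in> carrier_vec m" "y \<in> carrier_vec m"
  shows "switching_cost x y = (\<Sum>i<m. \<bar>real (y $ i) - real (x $ i)\<bar>)"
  using assms by (simp add: switching_cost_def l1_norm_def)

lemma movement_Suc: "movement (Suc n) z = movement n z + l1_norm (z (Suc n) - z n)"
  by (simp add: movement_def)

lemma total_cost_eq:
  "total_cost rs x =
     (\<Sum>t<length rs. service_cost (rs ! t) (x (Suc t)) + switching_cost (x t) (x (Suc t)))"
  unfolding total_cost_def
  by (rule sum.reindex_bij_witness[of _ Suc "\<lambda>t. t - 1"]) auto

text \<open>Odd positions change the state and raise \<open>s\<close> to the service cost; even ones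
  only lower \<open>s\<close> to 0. Position 0 is the origin, as the chasing problem demands, and
  not the lift of the initial state.\<close>

definition offline_path :: "nat \<Rightarrow> real vec list \<Rightarrow> (nat \<Rightarrow> nat vec) \<Rightarrow> nat \<Rightarrow> real vec" where
  "offline_path m rs x n =
     (if n = 0 then 0\<^sub>v (Suc m)
      else lift m (x (Suc n div 2)) (if odd n then service_cost (rs ! (n div 2)) (x (Suc n div 2)) else 0))"

lemma offline_path_simps:
  "offline_path m rs x 0 = 0\<^sub>v (Suc m)"
  "offline_path m rs x (Suc (2 * t)) = lift m (x (Suc t)) (service_cost (rs ! t) (x (Suc t)))"
  "offline_path m rs x (Suc (Suc (2 * t))) = lift m (x (Suc t)) 0"
  by (simp_all add: offline_path_def)

lemma round_cases:
  assumes "n \<in> {1..2 * T}"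
  obtains t where "t < T" "n = Suc (2 * t)" | t where "t < T" "n = Suc (Suc (2 * t))"
proof (cases "even n")
  case True
  then show ?thesis using assms that(2)[of "n div 2 - 1"] by (auto elim!: evenE)
next
  case False
  then show ?thesis using assms that(1)[of "n div 2"] by (auto elim!: oddE)
qed

lemma offline_path_feasible:
  assumes "set rs \<subseteq> workloads m" "1 \<le> m" "1 \<le> k" "x \<in> paths m k x0 (length rs)"
    and "n \<in> {1..2 * length rs}"
  shows "offline_path m rs x n \<in> positive_body (Suc m) 1 (bodies m k rs ! (n - 1))"
proof -
  have "rs ! t \<in> workloads m" "x (Suc t) \<in> states m k" if "t < length rs" for t
    using that assms(1,4) by (auto simp: paths_def)
  then show ?thesis
    using assms(5)
    by (elim round_cases)
      (simp_all add: offline_path_simps nth_bodies lift_in_serve_body[OF _ assms(2,3)] lift_in_reset_body)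
qed

text \<open>The distance term carries the jump from the origin to the initial state through the
  induction: it equals \<open>k\<close> at \<open>n = 0\<close> and vanishes afterwards. Service
  counts twice because \<open>s\<close> goes up and down.\<close>

lemma movement_offline_path:
  assumes "set rs \<subseteq> workloads m" "1 \<le> m" "x \<in> paths m k x0 (length rs)" "x0 \<in> states m k"
    and "n \<le> length rs"
  shows "movement (2 * n) (offline_path m rs x) + xdist m (offline_path m rs x (2 * n)) (lift m (x n) 0)
    \<le> real k + (\<Sum>t<n. 2 * service_cost (rs ! t) (x (Suc t)) + switching_cost (x t) (x (Suc t)))"
  using assms(5)
proof (induction n)
  case 0
  have "x 0 = x0" using assms(3) by (simp add: paths_def)
  then show ?case
    using states_sum[OF assms(4)] by (simp add: movement_def offline_path_simps xdist_def lift_def)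
next
  case (Suc n)
  let ?z = "offline_path m rs x" and ?f = "service_cost (rs ! n) (x (Suc n))"
  have st: "x t \<in> states m k" if "t \<le> length rs" for t
    using that assms(3,4) by (cases t) (auto simp: paths_def)
  have f: "0 \<le> ?f"
    using Suc.prems assms(1) by (intro service_cost_nonneg[OF _ assms(2)]) auto
  have z: "?z (2 * n) \<in> carrier_vec (Suc m)" "?z (2 * n) $ m = 0"
    by (cases n; simp add: offline_path_simps lift_def)+
  have sw: "switching_cost (x n) (x (Suc n)) = xdist m (lift m (x (Suc n)) 0) (lift m (x n) 0)"
    using st[of n] st[of "Suc n"] Suc.prems
    by (subst switching_cost_eq[of _ m]) (auto simp: states_def xdist_def lift_def)
  have "xdist m (?z (Suc (2 * n))) (?z (2 * n))
      \<le> xdist m (?z (2 * n)) (lift m (x n) 0) + switching_cost (x n) (x (Suc n))"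
    unfolding sw xdist_def sum.distrib[symmetric]
    by (intro sum_mono) (auto simp: offline_path_simps lift_def)
  moreover have "l1_norm (?z (Suc (2 * n)) - ?z (2 * n)) = xdist m (?z (Suc (2 * n))) (?z (2 * n)) + ?f"
    using z f by (subst l1_norm_diff[of _ m]) (auto simp: offline_path_simps lift_def)
  moreover have "l1_norm (?z (Suc (Suc (2 * n))) - ?z (Suc (2 * n))) = ?f"
    using f by (subst l1_norm_diff[of _ m]) (auto simp: offline_path_simps lift_def xdist_def)
  moreover have "xdist m (?z (2 * Suc n)) (lift m (x (Suc n)) 0) = 0"
    by (simp add: offline_path_simps xdist_def)
  ultimately show ?case
    using Suc by (simp add: movement_Suc)
qed


section \<open>Rounding\<close>

definition deficit :: "nat \<Rightarrow> nat vec \<Rightarrow> real vec \<Rightarrow> real" where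
  "deficit m x z = (\<Sum>i<m. max 0 (z $ i - 2 * real (x $ i) - 1))"

lemma deficit_nonneg: "0 \<le> deficit m x z"
  by (simp add: deficit_def sum_nonneg)

lemma deficit_lipschitz: "deficit m x w \<le> deficit m x z + xdist m w z"
  unfolding deficit_def xdist_def sum.distrib[symmetric] by (intro sum_mono) auto

lemma sum_update_two:
  fixes f g :: "nat \<Rightarrow> 'a :: ab_group_add"
  assumes "i < m" "j < m" "i \<noteq> j" "\<And>l. l < m \<Longrightarrow> l \<noteq> i \<Longrightarrow> l \<noteq> j \<Longrightarrow> f l = g l"
  shows "sum f {..<m} = sum g {..<m} + (f i - g i) + (f j - g j)"
proof -
  have "sum h {..<m} = h i + (h j + sum h ({..<m} - {i} - {j}))" for h :: "nat \<Rightarrow> 'a"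
    using assms(1-3) by (simp add: sum.remove[of _ i] sum.remove[of _ j])
  moreover have "sum f ({..<m} - {i} - {j}) = sum g ({..<m} - {i} - {j})"
    using assms(4) by (intro sum.cong) auto
  ultimately show ?thesis by (simp add: algebra_simps)
qed

text \<open>
  Moving a unit from an overfull coordinate \<open>j\<close> to a starved coordinate \<open>i\<close> costs at most 2 and
  lowers the deficit by 2 at \<open>i\<close> while raising it by less than 1 at \<open>j\<close>.
\<close>

lemma swap_improves:
  assumes "x \<in> states m k" "y \<in> states m k" "(\<Sum>i<m. z $ i) \<le> 2 * real k"
    and "i < m" "2 * real (y $ i) + 3 \<le> z $ i" and z: "\<And>i. i < m \<Longrightarrow> 0 \<le> z $ i"
  shows "\<exists>y'\<in>states m k. switching_cost x y' + 2 * deficit m y' z < switching_cost x y + 2 * deficit m y z"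
proof -
  \<comment> \<open>Averaging: otherwise \<open>z\<close> dominates \<open>2 y\<close> everywhere,
    strictly at \<open>i\<close>, and its sum exceeds \<open>2 k\<close>.\<close>
  have "\<exists>j<m. z $ j < 2 * real (y $ j)"
  proof (rule ccontr)
    assume "\<not> (\<exists>j<m. z $ j < 2 * real (y $ j))"
    then have le: "2 * real (y $ j) \<le> z $ j" if "j < m" for j
      using that by (meson not_less)
    have "2 * real (y $ i) < z $ i" using assms(5) by simp
    then have "(\<Sum>j<m. 2 * real (y $ j)) < (\<Sum>j<m. z $ j)"
      using assms(4) le by (intro sum_strict_mono_ex1) auto
    also have "(\<Sum>j<m. 2 * real (y $ j)) = 2 * real k"
      using states_sum[OF assms(2)] by (metis sum_distrib_left)
    finally show False using assms(3) by simp
  qed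
  then obtain j where j: "j < m" "z $ j < 2 * real (y $ j)" by blast
  have ij: "i \<noteq> j" using assms(5) j by auto
  \<comment> \<open>The donor has a unit to give, so the natural-number subtraction in
    \<open>y'\<close> is exact.\<close>
  have yj: "1 \<le> y $ j" using j z[of j] by (cases "y $ j") auto
  define y' where "y' = vec m (\<lambda>l. if l = i then y $ l + 1 else if l = j then y $ l - 1 else y $ l)"
  have y': "real (y' $ i) = real (y $ i) + 1" "real (y' $ j) = real (y $ j) - 1"
    "\<And>l. l < m \<Longrightarrow> l \<noteq> i \<Longrightarrow> l \<noteq> j \<Longrightarrow> y' $ l = y $ l"
    using assms(4) j ij yj by (auto simp: y'_def)
  have "(\<Sum>l<m. real (y' $ l)) = (\<Sum>l<m. real (y $ l))"
    using sum_update_two[OF assms(4) j(1) ij, of "\<lambda>l. real (y' $ l)" "\<lambda>l. real (y $ l)"] y' by simp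
  then have st: "y' \<in> states m k"
    using states_sum[OF assms(2)] by (simp add: states_def y'_def flip: of_nat_sum)
  have "switching_cost x y' \<le> switching_cost x y + 2"
    using sum_update_two[OF assms(4) j(1) ij,
        of "\<lambda>l. \<bar>real (y' $ l) - real (x $ l)\<bar>" "\<lambda>l. \<bar>real (y $ l) - real (x $ l)\<bar>"] y'
      assms(1,2) st
    by (simp add: switching_cost_eq[of _ m] states_def)
  \<comment> \<open>The threshold 3 makes the excess at \<open>i\<close> at least 2, so it drops by
    the full 2 without truncation. At \<open>j\<close> it was 0 and stays below 1, since
    \<open>z $ j < 2 * real (y $ j)\<close>.\<close>
  moreover have "deficit m y' z < deficit m y z - 1"
    using sum_update_two[OF assms(4) j(1) ij, of "\<lambda>l. max 0 (z $ l - 2 * real (y' $ l) - 1)"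
        "\<lambda>l. max 0 (z $ l - 2 * real (y $ l) - 1)"] y' assms(5) j
    by (simp add: deficit_def)
  ultimately show ?thesis by (intro bexI[OF _ st]) linarith
qed

definition rounded :: "nat \<Rightarrow> nat \<Rightarrow> nat vec \<Rightarrow> real vec \<Rightarrow> nat vec \<Rightarrow> bool" where
  "rounded m k x z y \<longleftrightarrow> y \<in> states m k \<and>
     switching_cost x y + 2 * deficit m y z \<le> 2 * deficit m x z \<and>
     (\<forall>i<m. z $ i < 2 * real (y $ i) + 3)"

text \<open>Instead of iterating exchanges, take a minimiser of switching cost plus twice the
  deficit over the finite state set. Comparison with \<open>x\<close> pays for the switch, and a
  starved coordinate would allow a strict improvement.\<close>

lemma rounded_exists:
  assumes "x \<in> states m k" "(\<Sum>i<m. z $ i) \<le> 2 * real k" "\<And>i. i < m \<Longrightarrow> 0 \<le> z $ i"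
  shows "\<exists>y. rounded m k x z y"
proof -
  let ?\<psi> = "\<lambda>y. switching_cost x y + 2 * deficit m y z"
  obtain y where y: "y \<in> states m k" "\<And>y'. y' \<in> states m k \<Longrightarrow> ?\<psi> y \<le> ?\<psi> y'"
    using ex_is_arg_min_if_finite[OF finite_states, of m k ?\<psi>] assms(1)
    by (auto simp: is_arg_min_linorder)
  have "switching_cost x x = 0"
    using assms(1) by (subst switching_cost_eq[of _ m]) (auto simp: states_def)
  moreover have "z $ i < 2 * real (y $ i) + 3" if "i < m" for i
    using swap_improves[OF assms(1) y(1) assms(2) that _ assms(3)] y(2) by (meson not_less)
  ultimately show ?thesis
    using y(1) y(2)[OF assms(1)] by (auto simp: rounded_def)
qed

text \<open>The tangent for \<open>y = y $ i\<close> touches at \<open>2 * y + 4\<close>, which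
  exceeds \<open>1 + z $ i\<close>. Left of the touching point it forces \<open>s\<close> to be at
  least \<open>r / (2 * y + 4)\<close>, and \<open>2 * y + 4 \<le> 4 * (1 + y)\<close>.\<close>

lemma rounded_service_cost:
  assumes "r \<in> workloads m" "1 \<le> m" "1 \<le> k" "z \<in> positive_body (Suc m) b (serve_body m k r)"
    and "rounded m k x z y"
  shows "service_cost r y \<le> 4 * z $ m"
proof (rule service_cost_le[OF assms(1,2)])
  fix i assume i: "i < m"
  note z = assms(4)[unfolded serve_body_iff[OF assms(3)]]
  define Y where "Y = real (y $ i)"
  have Y: "0 \<le> Y" by (simp add: Y_def)
  show "r $ i / (1 + real (y $ i)) \<le> 4 * z $ m"
  proof (cases "0 < r $ i")
    case True
    have "y $ i \<le> k"
      using member_le_sum[of i "{..<m}" "\<lambda>i. y $ i"] assms(5) i by (auto simp: rounded_def states_def)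
    then have row: "r $ i * (4 * Y + 7) \<le> r $ i * z $ i + (2 * Y + 4)\<^sup>2 * z $ m"
      using z i True by (auto simp: Y_def)
    have "r $ i * z $ i \<le> r $ i * (2 * Y + 3)"
      using assms(5) i True by (intro mult_left_mono) (auto simp: rounded_def Y_def intro: less_imp_le)
    then have "(2 * Y + 4) * r $ i \<le> (2 * Y + 4) * ((2 * Y + 4) * z $ m)"
      using row by (simp add: power2_eq_square algebra_simps)
    then have "r $ i \<le> (2 * Y + 4) * z $ m"
      using Y by (subst (asm) mult_le_cancel_left_pos) auto
    also have "\<dots> \<le> (4 * (1 + Y)) * z $ m"
      using Y z by (intro mult_right_mono) auto
    finally show ?thesis
      using Y by (simp add: divide_le_eq Y_def algebra_simps)
  next
    case False
    then show ?thesis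
      using workload_nonneg[OF assms(1) i] z by auto
  qed
qed


section \<open>The online algorithm\<close>

text \<open>Only the odd positions of \<open>z\<close>, which answer the serve bodies, are read.
  \<open>SOME\<close> fixes one choice, so reruns on longer prefixes agree.\<close>

primrec round_path :: "nat \<Rightarrow> nat \<Rightarrow> nat vec \<Rightarrow> (nat \<Rightarrow> real vec) \<Rightarrow> nat \<Rightarrow> nat vec" where
  "round_path m k x0 z 0 = x0"
| "round_path m k x0 z (Suc t) =
     (SOME y. rounded m k (round_path m k x0 z t) (z (Suc (2 * t))) y)"

lemma round_path_cong:
  assumes "\<And>s. s < t \<Longrightarrow> z (Suc (2 * s)) = w (Suc (2 * s))"
  shows "round_path m k x0 z t = round_path m k x0 w t"
  using assms by (induction t) auto

lemma round_path_rounded: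
  assumes "x0 \<in> states m k" "t < T"
    and "\<And>t. t < T \<Longrightarrow> (\<Sum>i<m. z (Suc (2 * t)) $ i) \<le> 2 * real k"
    and "\<And>t i. t < T \<Longrightarrow> i < m \<Longrightarrow> 0 \<le> z (Suc (2 * t)) $ i"
  shows "rounded m k (round_path m k x0 z t) (z (Suc (2 * t))) (round_path m k x0 z (Suc t))"
proof -
  have step: "rounded m k (round_path m k x0 z t) (z (Suc (2 * t))) (round_path m k x0 z (Suc t))"
    if "t < T" "round_path m k x0 z t \<in> states m k" for t
    unfolding round_path.simps
    by (rule someI_ex, rule rounded_exists[OF that(2) assms(3)[OF that(1)] assms(4)[OF that(1)]])
  have "round_path m k x0 z t \<in> states m k" if "t < T" for t
    using that
  proof (induction t)
    case (Suc t)
    then show ?case using step[of t] by (simp add: rounded_def)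
  qed (simp add: assms(1))
  then show ?thesis using step assms(2) by blast
qed

text \<open>Amortisation: the deficit pays for switching, and raising and lowering \<open>s\<close>
  pays for \<open>4 * s\<close>, up to the residues left by the resets. These cost at most
  \<open>6 / 2 ^ n\<close> in step \<open>n\<close>, which sums to the last term.\<close>

lemma round_path_cost:
  assumes rs: "set rs \<subseteq> workloads m" "1 \<le> m" "1 \<le> k"
    and z0: "z 0 = 0\<^sub>v (Suc m)"
    and z: "\<And>n. n \<in> {1..2 * length rs} \<Longrightarrow> z n \<in> positive_body (Suc m) 2 (bodies m k rs ! (n - 1))"
    and x: "\<And>t. t < length rs \<Longrightarrow> rounded m k (x t) (z (Suc (2 * t))) (x (Suc t))"
    and "n \<le> length rs"
  shows "(\<Sum>t<n. service_cost (rs ! t) (x (Suc t)) + switching_cost (x t) (x (Suc t)))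
     + 2 * deficit m (x n) (z (2 * n)) \<le> 2 * movement (2 * n) z + 12 * (1 - 1 / 2 ^ n)"
  using \<open>n \<le> length rs\<close>
proof (induction n)
  case 0
  show ?case by (simp add: z0 deficit_def movement_def)
next
  case (Suc n)
  then have n: "n < length rs" by simp
  let ?a = "z (2 * n)" and ?b = "z (Suc (2 * n))" and ?c = "z (Suc (Suc (2 * n)))"
  have b: "?b \<in> positive_body (Suc m) 2 (serve_body m k (rs ! n))"
    using z[of "Suc (2 * n)"] n by (simp add: nth_bodies)
  \<comment> \<open>The factor 2 is the relaxation of the packing rows.\<close>
  have reset: "z (2 * t) \<in> carrier_vec (Suc m) \<and> z (2 * t) $ m \<le> 2 / 2 ^ t" if "t \<le> length rs" for t
  proof (cases t)
    case 0
    then show ?thesis by (simp add: z0)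
  next
    case (Suc u)
    then have "z (2 * t) \<in> positive_body (Suc m) 2 (reset_body m u)"
      using z[of "2 * t"] that by (simp add: nth_bodies)
    then show ?thesis
      using Suc by (simp add: reset_body_iff pos_le_divide_eq mult.commute)
  qed
  have ab: "xdist m ?b ?a + (?b $ m - ?a $ m) \<le> l1_norm (?b - ?a)"
    using b reset[of n] n by (subst l1_norm_diff[of _ m]) (auto simp: serve_body_iff[OF rs(3)])
  have bc: "xdist m ?c ?b + (?b $ m - ?c $ m) \<le> l1_norm (?c - ?b)"
    using b reset[of "Suc n"] n by (subst l1_norm_diff[of _ m]) (auto simp: serve_body_iff[OF rs(3)])
  have "service_cost (rs ! n) (x (Suc n)) \<le> 4 * ?b $ m"
    using rs(1) n by (intro rounded_service_cost[OF _ rs(2,3) b x[OF n]]) auto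
  moreover have "switching_cost (x n) (x (Suc n)) + 2 * deficit m (x (Suc n)) ?b \<le> 2 * deficit m (x n) ?b"
    using x[OF n] by (simp add: rounded_def)
  moreover have "deficit m (x n) ?b \<le> deficit m (x n) ?a + xdist m ?b ?a"
    "deficit m (x (Suc n)) ?c \<le> deficit m (x (Suc n)) ?b + xdist m ?c ?b"
    by (rule deficit_lipschitz)+
  moreover have "?a $ m \<le> 2 * (1 / 2 ^ n)" "?c $ m \<le> 1 / 2 ^ n"
    using reset[of n] reset[of "Suc n"] n by auto
  moreover have "movement (2 * Suc n) z = movement (2 * n) z + l1_norm (?b - ?a) + l1_norm (?c - ?b)"
    by (simp add: movement_Suc)
  moreover have "12 * (1 - 1 / 2 ^ Suc n :: real) = 12 * (1 - 1 / 2 ^ n) + 6 * (1 / 2 ^ n)"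
    by simp
  moreover have c: "z (2 * Suc n) = ?c"
    by simp
  ultimately show ?case
    using Suc.IH[OF less_imp_le[OF n]] ab bc unfolding sum.lessThan_Suc c by linarith
qed

theorem theorem1:
  fixes C_PB :: real and m k :: nat and x0 :: "nat vec"
  assumes "is_pb_constant C_PB"
    and "m \<ge> 1" and "k \<ge> 1"
    and "x0 \<in> states m k"
  shows "\<exists>A :: real vec list \<Rightarrow> nat vec.
           \<forall>rs. set rs \<subseteq> workloads m \<longrightarrow>
             online_path x0 A rs \<in> paths m k x0 (length rs) \<and>
             ALG x0 A rs \<le> 10 * C_PB * OPT m k x0 rs + (5 * C_PB + 8) * real k + 16"
proof -
  obtain B :: "(real mat \<times> real mat) list \<Rightarrow> real vec" where
    B: "\<And>Ks t. \<forall>K\<in>set Ks. admissible_body (Suc m) K \<Longrightarrow> t \<in> {1..length Ks} \<Longrightarrow>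
          online_path (0\<^sub>v (Suc m)) B Ks t \<in> positive_body (Suc m) 2 (Ks ! (t - 1))"
    and B_competitive: "\<And>Ks z'. \<forall>K\<in>set Ks. admissible_body (Suc m) K \<Longrightarrow> z' 0 = 0\<^sub>v (Suc m) \<Longrightarrow>
          (\<And>t. t \<in> {1..length Ks} \<Longrightarrow> z' t \<in> positive_body (Suc m) 1 (Ks ! (t - 1))) \<Longrightarrow>
          movement (length Ks) (online_path (0\<^sub>v (Suc m)) B Ks) \<le> C_PB * movement (length Ks) z'"
    using assms(1) unfolding is_pb_constant_def Let_def by metis
  define chase where "chase rs = online_path (0\<^sub>v (Suc m)) B (bodies m k rs)" for rs
  define A where "A rs = round_path m k x0 (chase rs) (length rs)" for rs
  have "online_path x0 A rs \<in> paths m k x0 (length rs) \<and>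
        ALG x0 A rs \<le> 10 * C_PB * OPT m k x0 rs + (5 * C_PB + 8) * real k + 16"
    if rs: "set rs \<subseteq> workloads m" for rs
  proof -
    define x where "x = online_path x0 A rs"
    let ?T = "length rs"
    have adm: "\<forall>K\<in>set (bodies m k rs). admissible_body (Suc m) K"
      by (rule admissible_bodies[OF rs assms(2-4)])
    have z: "chase rs n \<in> positive_body (Suc m) 2 (bodies m k rs ! (n - 1))" if "n \<in> {1..2 * ?T}" for n
      using B[OF adm, of n] that by (simp add: chase_def)
    have zs: "chase rs (Suc (2 * t)) \<in> positive_body (Suc m) 2 (serve_body m k (rs ! t))" if "t < ?T" for t
      using z[of "Suc (2 * t)"] that by (simp add: nth_bodies)
    \<comment> \<open>Causality: the runs of \<open>A\<close> on all prefixes are parts of one run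
      on \<open>rs\<close>.\<close>
    have x: "x t = round_path m k x0 (chase rs) t" if t: "t \<le> ?T" for t
    proof -
      have "chase (take t rs) (Suc (2 * s)) = chase rs (Suc (2 * s))" if "s < t" for s
        using t that by (simp add: chase_def online_path_def bodies_take)
      then have "round_path m k x0 (chase (take t rs)) t = round_path m k x0 (chase rs) t"
        by (rule round_path_cong)
      then show ?thesis
        using t by (simp add: x_def online_path_def A_def)
    qed
    have rounded: "rounded m k (x t) (chase rs (Suc (2 * t))) (x (Suc t))" if "t < ?T" for t
      using round_path_rounded[OF assms(4) that, of "chase rs"] zs x that
      by (simp add: serve_body_iff[OF assms(3)])
    have x0: "x 0 = x0" by (simp add: x_def online_path_def)
    have "x t \<in> states m k" if "t \<in> {1..?T}" for t
      using rounded[of "t - 1"] that by (auto simp: rounded_def)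
    then have feasible: "x \<in> paths m k x0 ?T"
      by (simp add: paths_def x0)
    have "total_cost rs x + 2 * deficit m (x ?T) (chase rs (2 * ?T))
        \<le> 2 * movement (2 * ?T) (chase rs) + 12 * (1 - 1 / 2 ^ ?T)"
      unfolding total_cost_eq
      by (rule round_path_cost[OF rs assms(2,3) _ z rounded order_refl])
        (simp_all add: chase_def online_path_def)
    moreover have "12 * (1 - 1 / 2 ^ ?T) \<le> (12 :: real)"
      by simp
    ultimately have online: "total_cost rs x \<le> 2 * movement (2 * ?T) (chase rs) + 12"
      using deficit_nonneg[of m "x ?T" "chase rs (2 * ?T)"] by linarith
    obtain y where y: "y \<in> paths m k x0 ?T" "OPT m k x0 rs = total_cost rs y"
      using OPT_attained[OF assms(4)] by blast
    have sw: "0 \<le> switching_cost u v" for u v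
      by (simp add: switching_cost_def l1_norm_nonneg)
    have f: "0 \<le> service_cost (rs ! t) u" if "t < ?T" for t u
      using rs that by (intro service_cost_nonneg[OF _ assms(2)]) auto
    have "(\<Sum>t<?T. 2 * service_cost (rs ! t) (y (Suc t)) + switching_cost (y t) (y (Suc t)))
        \<le> 2 * total_cost rs y"
      unfolding total_cost_eq sum_distrib_left by (intro sum_mono) (use sw in auto)
    then have offline: "movement (2 * ?T) (offline_path m rs y) \<le> real k + 2 * OPT m k x0 rs"
      using movement_offline_path[OF rs assms(2) y(1) assms(4) order_refl] y(2)
        xdist_nonneg[of m "offline_path m rs y (2 * ?T)" "lift m (y ?T) 0"]
      by linarith
    have C: "0 \<le> C_PB" by (rule is_pb_constant_nonneg[OF assms(1)])
    have "movement (2 * ?T) (chase rs) \<le> C_PB * movement (2 * ?T) (offline_path m rs y)"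
      using B_competitive[OF adm, of "offline_path m rs y"] offline_path_feasible[OF rs assms(2,3) y(1)]
      by (simp add: chase_def offline_path_simps)
    also have "\<dots> \<le> C_PB * (real k + 2 * OPT m k x0 rs)"
      by (rule mult_left_mono[OF offline C])
    finally have "total_cost rs x \<le> 4 * (C_PB * OPT m k x0 rs) + 2 * (C_PB * real k) + 12"
      using online by (simp add: algebra_simps)
    moreover have "0 \<le> OPT m k x0 rs"
      unfolding y(2) total_cost_eq by (intro sum_nonneg add_nonneg_nonneg) (use f sw in auto)
    then have "0 \<le> C_PB * OPT m k x0 rs" "0 \<le> C_PB * real k"
      using C by simp_all
    \<comment> \<open>The sharper constants 4, 2 and 12 are weakened to the stated ones, using
      nonnegativity.\<close>
    ultimately have "total_cost rs x \<le> 10 * (C_PB * OPT m k x0 rs) + 5 * (C_PB * real k) + 8 * real k + 16"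
      by simp
    then show ?thesis
      using feasible by (simp add: ALG_def x_def algebra_simps)
  qed
  then show ?thesis by blast
qed

end
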